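(* Let $(S,A,T,\beta)$ be a finite MDP with two target sets $Z_\phi,Z_\psi\subseteq S$. The class of switching policies $\pi_{s\to s}$ is a dominating class of policies for the constrained reachability problem; that is, for every (possibly history-dependent and randomized) policy $\pi$ there exists a switching policy $\pi_{s\to s}$ (with stationary pre-switch policy $\pi_{\mathrm{mix}}$ and stationary post-switch policies $\pi_\psi,\pi_\phi$, as defined in the context) such that $$P_{\pi_{s\to s}}(\sigma\models\lozenge Z_\phi)\ge P_\pi(\sigma\models\lozenge Z_\phi)\quad\text{and}\quad P_{\pi_{s\to s}}(\sigma\models\lozenge Z_\psi)\ge P_\pi(\sigma\models\lozenge Z_\psi).$$
   Context: Finite MDP: $S$ is a finite set of states; $A$ a finite set of actions, with a nonempty set $A(s)\subseteq A$ of allowed actions at each $s$; $T:S\times A\times S\to[0,1]$ with $\sum_{s'}T(s,a,s')=1$ if $a\in A(s)$ and $=0$ otherwise; $\beta$ is a probability distribution on $S$ (initial distribution). (Labels on states play no role here.) A policy maps each finite state-action history $h_t=(s_0,a_0,\ldots,s_t)$ (and the time $t$) to a probability distribution on $A(s_t)$. It is stationary if this distribution depends only on $s_t$. A policy $\pi$ induces a probability measure $P_\pi$ on infinite trajectories: $s_0\sim\beta$, $a_t\sim\pi(h_t,t)$, $s_{t+1}\sim T(s_t,a_t,\cdot)$. A path $\sigma$ is the state sequence $s_0s_1s_2\cdots$; $\sigma\models\lozenge Y$, for $Y\subseteq S$, means that $s_t\in Y$ for some $t\ge0$. $P_\pi(s\models\lozenge Y)$ is the probability of this event when the process starts at $s_0=s$.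 Switching policy $\pi_{s\to s}$: let $Z=Z_\phi\cup Z_\psi$. It is built from a stationary pre-switch policy $\pi_{\mathrm{mix}}$ and two stationary post-switch policies $\pi_\psi,\pi_\phi$, where $\pi_\psi$ (resp. $\pi_\phi$) maximizes, over all policies and from every starting state, the probability of reaching $Z_\psi$ (resp. $Z_\phi$). The policy follows $\pi_{\mathrm{mix}}$ as long as no state of $Z$ has been visited. From the first visit to $Z$ on (including at that first visited state $j$), it follows $\pi_\psi$ forever if $j\in Z_\phi\setminus Z_\psi$, and $\pi_\phi$ forever if $j\in Z_\psi\setminus Z_\phi$. Once both $Z_\phi$ and $Z_\psi$ have been visited, the choice of actions is irrelevant and may be arbitrary. *)

theory Defs
  imports "HOL-Probability.Probability"
begin

locale finite_mdp =
  fixes A :: "'s::finite \<Rightarrow> 'a::finite set"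
    and T :: "'s \<Rightarrow> 'a \<Rightarrow> 's \<Rightarrow> real"
  assumes A_nonempty: "A s \<noteq> {}"
    and T_nonneg: "0 \<le> T s a s'"
    and T_le_1: "T s a s' \<le> 1"
    and T_sum: "(\<Sum>s'\<in>UNIV. T s a s') = (if a \<in> A s then 1 else 0)"

text \<open>
  A history \<open>(s\<^sub>0, a\<^sub>0, \<dots>, s\<^sub>t)\<close> is given by the list \<open>[(s\<^sub>0, a\<^sub>0), \<dots>, (s\<^sub>t\<^sub>-\<^sub>1, a\<^sub>t\<^sub>-\<^sub>1)]\<close> of the
  past state-action pairs and the current state \<open>s\<^sub>t\<close>; the time \<open>t\<close> is the length of the list.
\<close>

type_synonym ('s, 'a) policy = "('s \<times> 'a) list \<Rightarrow> 's \<Rightarrow> 'a pmf"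

definition is_policy :: "('s \<Rightarrow> 'a set) \<Rightarrow> ('s, 'a) policy \<Rightarrow> bool" where
  "is_policy A \<pi> \<longleftrightarrow> (\<forall>h s. set_pmf (\<pi> h s) \<subseteq> A s)"

definition is_stationary_policy :: "('s \<Rightarrow> 'a set) \<Rightarrow> ('s, 'a) policy \<Rightarrow> bool" where
  "is_stationary_policy A \<pi> \<longleftrightarrow> is_policy A \<pi> \<and> (\<forall>h h' s. \<pi> h s = \<pi> h' s)"

text \<open>
  Distribution of the \<open>t\<close>-th state-action pair, given that the earlier pairs are \<open>\<omega> 0, \<dots>, \<omega> (t - 1)\<close>.
  For a disallowed action \<open>a\<close>, \<open>T s a\<close> is not a probability mass function and \<open>embed_pmf (T s a)\<close> is
  unspecified, but under a policy such an action has probability zero.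
\<close>

definition step_pmf ::
  "('s \<Rightarrow> 'a \<Rightarrow> 's \<Rightarrow> real) \<Rightarrow> 's pmf \<Rightarrow> ('s, 'a) policy \<Rightarrow> nat \<Rightarrow> (nat \<Rightarrow> 's \<times> 'a) \<Rightarrow> ('s \<times> 'a) pmf"
where
  "step_pmf T \<beta> \<pi> t \<omega> =
    bind_pmf (case t of 0 \<Rightarrow> \<beta> | Suc u \<Rightarrow> embed_pmf (T (fst (\<omega> u)) (snd (\<omega> u))))
      (\<lambda>s. map_pmf (Pair s) (\<pi> (map \<omega> [0..<t]) s))"

lemma (in finite_mdp) pmf_embed_T:
  assumes "a \<in> A s"
  shows "pmf (embed_pmf (T s a)) s' = T s a s'"
proof (rule pmf_embed_pmf)
  show "(\<integral>\<^sup>+ x. ennreal (T s a x) \<partial>count_space UNIV) = 1"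
    using assms by (simp add: nn_integral_count_space_finite sum_ennreal T_nonneg T_sum)
qed (rule T_nonneg)

lemma Ionescu_Tulcea_step_pmf:
  fixes T :: "'s::finite \<Rightarrow> 'a::finite \<Rightarrow> 's \<Rightarrow> real"
  shows "Ionescu_Tulcea (\<lambda>t \<omega>. measure_pmf (step_pmf T \<beta> \<pi> t \<omega>)) (\<lambda>_. count_space UNIV)"
proof
  fix i :: nat
  have eq: "PiM {0..<i} (\<lambda>_. count_space (UNIV :: ('s \<times> 'a) set))
      = count_space (PiE {0..<i} (\<lambda>_. UNIV))"
    by (rule count_space_PiM_finite) (auto intro: countable_finite)
  show "(\<lambda>\<omega>. measure_pmf (step_pmf T \<beta> \<pi> i \<omega>))
      \<in> measurable (PiM {0..<i} (\<lambda>_. count_space UNIV)) (subprob_algebra (count_space UNIV))"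
    unfolding eq by (auto intro: measure_pmf_in_subprob_algebra)
qed

text \<open>The measure on infinite trajectories is the Ionescu-Tulcea extension of the one-step kernels.\<close>

global_interpretation traj: Ionescu_Tulcea
  "\<lambda>t \<omega>. measure_pmf (step_pmf T \<beta> \<pi> t \<omega>)" "\<lambda>_. count_space UNIV"
  for T :: "'s::finite \<Rightarrow> 'a::finite \<Rightarrow> 's \<Rightarrow> real" and \<beta> :: "'s pmf" and \<pi> :: "('s, 'a) policy"
  by (rule Ionescu_Tulcea_step_pmf)

definition trajectory_measure ::
  "('s::finite \<Rightarrow> 'a::finite \<Rightarrow> 's \<Rightarrow> real) \<Rightarrow> 's pmf \<Rightarrow> ('s, 'a) policy \<Rightarrow> (nat \<Rightarrow> 's \<times> 'a) measure"
where
  "trajectory_measure T \<beta> \<pi> = traj.PF.lim T \<beta> \<pi>"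

definition prob_reach ::
  "('s::finite \<Rightarrow> 'a::finite \<Rightarrow> 's \<Rightarrow> real) \<Rightarrow> 's pmf \<Rightarrow> ('s, 'a) policy \<Rightarrow> 's set \<Rightarrow> real"
where
  "prob_reach T \<beta> \<pi> Y = measure (trajectory_measure T \<beta> \<pi>) {\<omega>. \<exists>t. fst (\<omega> t) \<in> Y}"

lemma sets_trajectory_measure:
  "sets (trajectory_measure T \<beta> \<pi>) = sets (PiM UNIV (\<lambda>_. count_space UNIV))"
  unfolding trajectory_measure_def by (rule traj.PF.sets_lim)

lemma sets_reach:
  "{\<omega>. \<exists>t. fst (\<omega> t) \<in> Y} \<in> sets (trajectory_measure T \<beta> \<pi>)"
proof -
  have "Measurable.pred (PiM UNIV (\<lambda>_. count_space UNIV)) (\<lambda>\<omega>. \<exists>t::nat. fst (\<omega> t) \<in> Y)"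
    by (rule pred_intros_countable(2), rule measurable_compose[OF measurable_component_singleton]) auto
  then show ?thesis
    by (simp add: pred_def space_PiM sets_trajectory_measure)
qed

lemma step_pmf_restrict: "step_pmf T \<beta> \<pi> n (restrict x {0..<n}) = step_pmf T \<beta> \<pi> n x"
  by (auto simp: step_pmf_def intro!: bind_pmf_cong map_pmf_cong arg_cong2[where f=\<pi>]
      split: nat.split cong: map_cong)

lemma emeasure_C_singleton:
  "emeasure (traj.C T \<beta> \<pi> 0 n (\<lambda>_. undefined)) {restrict x {0..<n}} = ennreal (\<Prod>i<n. pmf (step_pmf T \<beta> \<pi> i x) (x i))"
proof (induction n)
  case 0 
  then show ?case by (simp add: PiM_empty restrict_def)
next
  case (Suc n)
  let ?P = "\<lambda>n::nat. PiM {0..<n} (\<lambda>_. count_space (UNIV :: ('a \<times> 'b) set))"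
  let ?C = "traj.C T \<beta> \<pi> 0 n (\<lambda>_. undefined)"
  have PiM_eq: "?P n = count_space (PiE {0..<n} (\<lambda>_. UNIV))" for n :: nat
    by (rule count_space_PiM_finite) (auto intro: countable_finite)
  have u: "(\<lambda>_. undefined) \<in> space (?P 0)" by (simp add: space_PiM)
  have sC: "sets ?C = sets (?P n)" using traj.sets_C[OF u] by simp
  have spC: "space ?C = space (?P n)" using traj.space_C[OF u] by simp
  have X: "{restrict x {0..<Suc n}} \<in> sets (?P (Suc n))" unfolding PiM_eq by simp
  have "emeasure (traj.C T \<beta> \<pi> 0 (Suc n) (\<lambda>_. undefined)) {restrict x {0..<Suc n}}
     = (\<integral>\<^sup>+\<omega>. emeasure (traj.eP T \<beta> \<pi> n \<omega>) {restrict x {0..<Suc n}} \<partial>?C)"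
    using traj.measurable_eP[of T \<beta> \<pi> n] X
    by (subst traj.C.simps, subst emeasure_bind[where N = "?P (Suc n)"])
       (auto simp: spC measurable_cong_sets[OF sC refl] space_PiM PiE_eq_empty_iff)
  also have "\<dots> = (\<integral>\<^sup>+\<omega>. ennreal (pmf (step_pmf T \<beta> \<pi> n x) (x n)) * indicator {restrict x {0..<n}} \<omega> \<partial>?C)"
  proof (rule nn_integral_cong)
    fix \<omega> assume "\<omega> \<in> space ?C"
    then have w: "\<omega> \<in> space (?P n)" by (simp add: spC)
    then have ext: "\<omega> \<in> extensional {0..<n}" by (simp add: space_PiM PiE_def)
    have iff: "fun_upd \<omega> n y = restrict x {0..<Suc n} \<longleftrightarrow> y = x n \<and> \<omega> = restrict x {0..<n}" for y
      using ext by (auto simp: fun_eq_iff extensional_def restrict_def less_Suc_eq)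
    have "emeasure (traj.eP T \<beta> \<pi> n \<omega>) {restrict x {0..<Suc n}}
        = emeasure (step_pmf T \<beta> \<pi> n \<omega>) {y. y = x n \<and> \<omega> = restrict x {0..<n}}"
      using traj.emeasure_eP[OF w X] by (simp add: vimage_def iff)
    also have "\<dots> = ennreal (pmf (step_pmf T \<beta> \<pi> n x) (x n)) * indicator {restrict x {0..<n}} \<omega>"
      by (cases "\<omega> = restrict x {0..<n}") (auto simp: emeasure_pmf_single step_pmf_restrict)
    finally show "emeasure (traj.eP T \<beta> \<pi> n \<omega>) {restrict x {0..<Suc n}}
        = ennreal (pmf (step_pmf T \<beta> \<pi> n x) (x n)) * indicator {restrict x {0..<n}} \<omega>" .
  qed
  also have "\<dots> = ennreal (pmf (step_pmf T \<beta> \<pi> n x) (x n)) * emeasure ?C {restrict x {0..<n}}"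
    by (rule nn_integral_cmult_indicator) (simp add: sC PiM_eq)
  also have "\<dots> = ennreal (\<Prod>i<Suc n. pmf (step_pmf T \<beta> \<pi> i x) (x i))"
    by (simp add: Suc.IH ennreal_mult[symmetric] prod_nonneg mult.commute)
  finally show ?case .
qed

lemma emeasure_trajectory_cylinder:
  "emeasure (trajectory_measure T \<beta> \<pi>) {\<omega>. \<forall>i<n. \<omega> i = x i}
    = ennreal (\<Prod>i<n. pmf (step_pmf T \<beta> \<pi> i x) (x i))"
proof -
  let ?P = "\<lambda>J::nat set. PiM J (\<lambda>_. count_space (UNIV :: ('a \<times> 'b) set))"
  let ?X = "{restrict x {0..<n}}"
  have "?P {0..<n} = count_space (PiE {0..<n} (\<lambda>_. UNIV))"
    by (rule count_space_PiM_finite) (auto intro: countable_finite)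
  then have X: "?X \<in> sets (?P {0..<n})" by simp
  have "{\<omega>. \<forall>i<n. \<omega> i = x i} = traj.PF.emb UNIV {0..<n} ?X"
    by (auto simp: prod_emb_def fun_eq_iff restrict_def) metis
  moreover have "traj.PF.emb {0..<n} {0..<n} ?X = ?X"
    by (rule prod_emb_id) (auto)
  ultimately show ?thesis
    using traj.lim[of "{0..<n}" ?X T \<beta> \<pi>] traj.emeasure_CI[of "{0..<n}" n ?X T \<beta> \<pi>] X
      emeasure_C_singleton[of T \<beta> \<pi> n x]
    by (simp add: trajectory_measure_def)
qed

definition maximizes_reach ::
  "('s::finite \<Rightarrow> 'a::finite set) \<Rightarrow> ('s \<Rightarrow> 'a \<Rightarrow> 's \<Rightarrow> real) \<Rightarrow> 's set \<Rightarrow> ('s, 'a) policy \<Rightarrow> bool"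
where
  "maximizes_reach A T Y \<rho> \<longleftrightarrow> is_policy A \<rho> \<and>
    (\<forall>\<pi> s. is_policy A \<pi> \<longrightarrow> prob_reach T (return_pmf s) \<pi> Y \<le> prob_reach T (return_pmf s) \<rho> Y)"

text \<open>
  The current state counts as visited, so the switch already affects the action chosen at the
  first state of \<open>Z\<phi> \<union> Z\<psi>\<close>. Once both sets have been visited, the actions are unconstrained; this
  includes the case that the first visited state \<open>j\<close> lies in \<open>Z\<phi> \<inter> Z\<psi>\<close>.
\<close>

definition follows_switching ::
  "'s set \<Rightarrow> 's set \<Rightarrow> ('s, 'a) policy \<Rightarrow> ('s, 'a) policy \<Rightarrow> ('s, 'a) policy \<Rightarrow> ('s, 'a) policy \<Rightarrow> bool"
where
  "follows_switching Z\<phi> Z\<psi> \<pi>mix \<pi>\<psi> \<pi>\<phi> \<pi> \<longleftrightarrow>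
    (\<forall>h s. let path = map fst h @ [s] in
      case find (\<lambda>x. x \<in> Z\<phi> \<union> Z\<psi>) path of
        None \<Rightarrow> \<pi> h s = \<pi>mix h s
      | Some j \<Rightarrow>
          \<not> (set path \<inter> Z\<phi> \<noteq> {} \<and> set path \<inter> Z\<psi> \<noteq> {}) \<longrightarrow>
            (j \<in> Z\<phi> - Z\<psi> \<longrightarrow> \<pi> h s = \<pi>\<psi> h s) \<and>
            (j \<in> Z\<psi> - Z\<phi> \<longrightarrow> \<pi> h s = \<pi>\<phi> h s))"

definition is_switching_policy ::
  "('s::finite \<Rightarrow> 'a::finite set) \<Rightarrow> ('s \<Rightarrow> 'a \<Rightarrow> 's \<Rightarrow> real) \<Rightarrow> 's set \<Rightarrow> 's set \<Rightarrow> ('s, 'a) policy \<Rightarrow> bool"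
where
  "is_switching_policy A T Z\<phi> Z\<psi> \<pi> \<longleftrightarrow> is_policy A \<pi> \<and>
    (\<exists>\<pi>mix \<pi>\<psi> \<pi>\<phi>.
      is_stationary_policy A \<pi>mix \<and>
      is_stationary_policy A \<pi>\<psi> \<and> maximizes_reach A T Z\<psi> \<pi>\<psi> \<and>
      is_stationary_policy A \<pi>\<phi> \<and> maximizes_reach A T Z\<phi> \<pi>\<phi> \<and>
      follows_switching Z\<phi> Z\<psi> \<pi>mix \<pi>\<psi> \<pi>\<phi> \<pi>)"


end

theory Submission
  imports Defs
begin

text \<open>
  Replace each target set by a terminal reward, collected at the first visit \<open>j\<close> to
  \<open>Z = Z\<phi> \<union> Z\<psi>\<close>: the optimal probability of reaching that set from \<open>j\<close>. No policy does better
  than this after the first visit, and the switching policy attains it. Hence it suffices to find a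
  stationary policy whose two expected rewards dominate given numbers \<open>w\<close>. By Farkas' lemma,
  a flow of state-action frequencies earning \<open>w\<close> exists unless some nonnegative function \<open>g\<close>,
  superharmonic off \<open>Z\<close> and equal on \<open>Z\<close> to a nonnegative combination of the rewards, has
  \<open>\<beta> g\<close> below the corresponding combination of \<open>w\<close>; but superharmonic functions bound the
  expected reward of every policy. Normalizing the flow gives the policy. Working with flows instead
  of the occupation measure of \<open>\<pi>\<close> avoids infinite expected numbers of visits. Stationary
  optimal policies for a single target arise from the same argument with one reward and
  \<open>w\<close> the sum over all start states of the optimal values.
\<close>

section \<open>Farkas' lemma\<close>

text \<open>If \<open>w\<close> lay outside the closed cone generated by the rows of
  \<open>M\<close> and the negative unit vectors, the negated normal of a separating hyperplane
  would be a \<open>p\<close> contradicting \<open>dual\<close>.\<close>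

lemma farkas_inequalities:
  fixes M :: "'i::finite \<Rightarrow> 'k::finite \<Rightarrow> real" and w :: "'k \<Rightarrow> real"
  assumes dual: "\<And>p. (\<And>k. 0 \<le> p k) \<Longrightarrow> (\<And>i. (\<Sum>k\<in>UNIV. p k * M i k) \<le> 0) \<Longrightarrow> (\<Sum>k\<in>UNIV. p k * w k) \<le> 0"
  shows "\<exists>y. (\<forall>i. 0 \<le> y i) \<and> (\<forall>k. w k \<le> (\<Sum>i\<in>UNIV. y i * M i k))"
proof -
  \<comment> \<open>The negative unit vectors supply the slack between equality and
    \<open>\<le>\<close>; dually, they force the multipliers to be nonnegative.\<close>
  define G where "G = range (\<lambda>i. \<chi> k. M i k) \<union> range (\<lambda>k. - axis k (1::real))"
  define C :: "(real^'k) set" where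
    "C = {z. \<exists>y. (\<forall>i. 0 \<le> y i) \<and> (\<forall>k. z $ k \<le> (\<Sum>i\<in>UNIV. y i * M i k))}"
  have "convex_cone C"
    unfolding convex_cone_iff
  proof (intro conjI allI impI ballI)
    show "0 \<in> C" unfolding C_def by (auto intro!: exI[of _ "\<lambda>_. 0"])
  next
    fix x z assume "x \<in> C" "z \<in> C"
    then obtain y y' where "\<forall>i. 0 \<le> y i" "\<forall>k. x $ k \<le> (\<Sum>i\<in>UNIV. y i * M i k)"
      "\<forall>i. 0 \<le> y' i" "\<forall>k. z $ k \<le> (\<Sum>i\<in>UNIV. y' i * M i k)"
      unfolding C_def by blast
    then have "\<forall>i. 0 \<le> y i + y' i" "\<forall>k. (x + z) $ k \<le> (\<Sum>i\<in>UNIV. (y i + y' i) * M i k)"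
      by (simp_all add: distrib_right sum.distrib add_mono)
    then show "x + z \<in> C" unfolding C_def by (auto intro!: exI[of _ "\<lambda>i. y i + y' i"])
  next
    fix x :: "real^'k" and c :: real assume "x \<in> C" "0 \<le> c"
    then obtain y where "\<forall>i. 0 \<le> y i" "\<forall>k. x $ k \<le> (\<Sum>i\<in>UNIV. y i * M i k)"
      unfolding C_def by blast
    with \<open>0 \<le> c\<close> have "\<forall>i. 0 \<le> c * y i" "\<forall>k. (c *\<^sub>R x) $ k \<le> (\<Sum>i\<in>UNIV. (c * y i) * M i k)"
      by (simp_all add: mult.assoc sum_distrib_left[symmetric] mult_left_mono)
    then show "c *\<^sub>R x \<in> C" unfolding C_def by (auto intro!: exI[of _ "\<lambda>i. c * y i"])
  qed
  moreover have "G \<subseteq> C"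
  proof
    fix x assume "x \<in> G"
    then consider i where "x = (\<chi> k. M i k)" | k where "x = - axis k 1"
      unfolding G_def by blast
    then show "x \<in> C"
    proof cases
      case 1
      have "(\<Sum>j\<in>UNIV. (if j = i then 1 else 0) * M j k) = M i k" for k
        by (simp add: if_distrib[of "\<lambda>x. x * _"] cong: if_cong)
      with 1 show ?thesis unfolding C_def
        by (auto intro!: exI[of _ "\<lambda>j. if j = i then 1 else 0"])
    next
      case 2
      then show ?thesis unfolding C_def by (auto intro!: exI[of _ "\<lambda>_. 0"] simp: axis_def)
    qed
  qed
  ultimately have hull: "convex_cone hull G \<subseteq> C"
    by (simp add: hull_minimal)
  have "(\<chi> k. w k) \<in> convex_cone hull G"
  proof (rule ccontr)
    assume out: "(\<chi> k. w k) \<notin> convex_cone hull G"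
    have "finite G" unfolding G_def by simp
    then have "closed (convex_cone hull G)" by (rule closed_convex_cone_hull)
    moreover have "convex (convex_cone hull G)"
      using convex_cone_convex_cone_hull convex_cone_def by metis
    ultimately obtain p b where p: "p \<bullet> (\<chi> k. w k) < b" "\<And>x. x \<in> convex_cone hull G \<Longrightarrow> b < p \<bullet> x"
      using separating_hyperplane_closed_point[OF _ _ out] by metis
    have "b < 0" using p(2)[OF convex_cone_hull_contains_0] by simp
    \<comment> \<open>Otherwise scaling \<open>x\<close> by the nonnegative factor
      \<open>b / (p \<bullet> x)\<close> would give a point of the cone where \<open>p\<close> takes
      the value \<open>b\<close> exactly, against strict separation.\<close>
    have pos: "0 \<le> p \<bullet> x" if "x \<in> G" for x
    proof (rule ccontr)
      assume "\<not> 0 \<le> p \<bullet> x"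
      then have neg: "p \<bullet> x < 0" by simp
      with \<open>b < 0\<close> have "0 \<le> b / (p \<bullet> x)" by (simp add: divide_nonpos_neg)
      then have "(b / (p \<bullet> x)) *\<^sub>R x \<in> convex_cone hull G"
        using that by (intro convex_cone_hull_mul hull_inc)
      from p(2)[OF this] neg show False by simp
    qed
    have "(\<Sum>k\<in>UNIV. - p $ k * w k) \<le> 0"
    proof (rule dual)
      fix k
      have "0 \<le> p \<bullet> (- axis k 1)" by (rule pos) (simp add: G_def)
      then show "0 \<le> - p $ k" by (simp add: inner_axis)
    next
      fix i
      have "0 \<le> p \<bullet> (\<chi> k. M i k)" by (rule pos) (simp add: G_def)
      then show "(\<Sum>k\<in>UNIV. - p $ k * M i k) \<le> 0" by (simp add: inner_vec_def sum_negf)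
    qed
    with p(1) \<open>b < 0\<close> show False by (simp add: inner_vec_def sum_negf)
  qed
  with hull have "(\<chi> k. w k) \<in> C" by blast
  then show ?thesis unfolding C_def by simp
qed

section \<open>Flows and stationary policies\<close>

context finite_mdp
begin

text \<open>
  Linear programming duality: the dual variables are a nonnegative function superharmonic off \<open>Z\<close>
  together with weights on the rewards, the primal ones are the entries \<open>y s a\<close> of a flow whose
  normalization is the stationary policy. For the total outflow \<open>Y\<close>, the transition matrix \<open>P\<close> of
  that policy and its value \<open>f\<close>, the flow earns \<open>Y (f - P f) = (Y - Y P) f \<le> b f\<close> off \<open>Z\<close>.
  Finiteness of \<open>y\<close> is all that is needed: the flow may contain circulations that never reach \<open>Z\<close>.
\<close>

lemma ex_stationary_dominating:
  fixes r :: "'i::finite \<Rightarrow> 's \<Rightarrow> real" and w :: "'i \<Rightarrow> real" and b :: "'s \<Rightarrow> real"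
  assumes dual: "\<And>l g. (\<And>i. 0 \<le> l i) \<Longrightarrow> (\<And>s. s \<notin> Z \<Longrightarrow> 0 \<le> g s)
      \<Longrightarrow> (\<And>s. s \<in> Z \<Longrightarrow> g s = (\<Sum>i\<in>UNIV. l i * r i s))
      \<Longrightarrow> (\<And>s a. s \<notin> Z \<Longrightarrow> a \<in> A s \<Longrightarrow> (\<Sum>s'\<in>UNIV. T s a s' * g s') \<le> g s)
      \<Longrightarrow> (\<Sum>i\<in>UNIV. l i * w i) \<le> (\<Sum>s\<in>UNIV. b s * g s)"
  obtains \<sigma> where "\<And>s. set_pmf (\<sigma> s) \<subseteq> A s"
    and "\<And>i f. (\<And>s. s \<notin> Z \<Longrightarrow> 0 \<le> f s)
      \<Longrightarrow> (\<And>s. s \<notin> Z \<Longrightarrow> f s = (\<Sum>a\<in>UNIV. pmf (\<sigma> s) a * (\<Sum>s'\<in>UNIV. T s a s' * f s')))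
      \<Longrightarrow> (\<And>s. s \<in> Z \<Longrightarrow> f s = r i s) \<Longrightarrow> w i \<le> (\<Sum>s\<in>UNIV. b s * f s)"
proof -
  define ok where "ok = (\<lambda>s a. s \<notin> Z \<and> a \<in> A s)"
  \<comment> \<open>Column \<open>Inl s'\<close> is the net inflow at \<open>s'\<close>, column
    \<open>Inr i\<close> the reward earned on entering \<open>Z\<close>. Farkas' lemma ranges over
    whole types, so pairs closed to the flow and balances at states of \<open>Z\<close> are filled
    with zeros.\<close>
  define M where "M = (\<lambda>(s, a) k. if ok s a then (case k of
      Inl s' \<Rightarrow> if s' \<in> Z then 0 else T s a s' - (if s' = s then 1 else 0)
    | Inr i \<Rightarrow> \<Sum>j\<in>Z. T s a j * r i j) else 0)"
  \<comment> \<open>Net inflow may be as low as \<open>- b s\<close>, since \<open>b s\<close> is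
    supplied from outside. Mass starting in \<open>Z\<close> is rewarded at once, so only the
    remainder of \<open>w i\<close> must come from the flow.\<close>
  define v where "v = (\<lambda>k. case k of Inl s \<Rightarrow> if s \<in> Z then 0 else - b s
    | Inr i \<Rightarrow> w i - (\<Sum>j\<in>Z. b j * r i j))"
  have sum_Plus: "(\<Sum>k\<in>UNIV. h k) = (\<Sum>s\<in>UNIV. h (Inl s)) + (\<Sum>i\<in>UNIV. h (Inr i))"
    for h :: "'s + 'i \<Rightarrow> real"
    using sum.Plus[of UNIV UNIV h] by (simp add: comp_def)
  have split: "(\<Sum>s\<in>UNIV. h s) = (\<Sum>s\<in>Z. h s) + (\<Sum>s\<in>-Z. h s)" for h :: "'s \<Rightarrow> real"
    by (subst sum.union_disjoint[symmetric]) auto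
  have "\<exists>y. (\<forall>sa. 0 \<le> y sa) \<and> (\<forall>k. v k \<le> (\<Sum>sa\<in>UNIV. y sa * M sa k))"
  proof (rule farkas_inequalities)
    fix p :: "'s + 'i \<Rightarrow> real"
    assume p: "\<And>k. 0 \<le> p k" and pM: "\<And>sa. (\<Sum>k\<in>UNIV. p k * M sa k) \<le> 0"
    \<comment> \<open>The multipliers of the balances become values off \<open>Z\<close>; extending
      them by the weighted rewards turns each row inequality into superharmonicity for one
      state-action pair.\<close>
    define g where "g = (\<lambda>s. if s \<in> Z then \<Sum>i\<in>UNIV. p (Inr i) * r i s else p (Inl s))"
    have "(\<Sum>i\<in>UNIV. p (Inr i) * w i) \<le> (\<Sum>s\<in>UNIV. b s * g s)"
    proof (rule dual)
      fix s a assume sa: "s \<notin> Z" "a \<in> A s"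
      have "(\<Sum>s'\<in>UNIV. p (Inl s') * (if s' \<in> Z then 0 else T s a s' - (if s' = s then 1 else 0)))
          = (\<Sum>s'\<in>-Z. p (Inl s') * T s a s' - (if s' = s then p (Inl s') else 0))"
        by (subst split) (auto intro!: sum.cong simp: algebra_simps)
      also have "\<dots> = (\<Sum>s'\<in>-Z. T s a s' * g s') - g s"
        using sa by (simp add: sum_subtractf g_def mult.commute)
      finally have 1: "(\<Sum>s'\<in>UNIV. p (Inl s') * (if s' \<in> Z then 0 else T s a s' - (if s' = s then 1 else 0)))
          = (\<Sum>s'\<in>-Z. T s a s' * g s') - g s" .
      have 2: "(\<Sum>i\<in>UNIV. p (Inr i) * (\<Sum>j\<in>Z. T s a j * r i j)) = (\<Sum>j\<in>Z. T s a j * g j)"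
        by (simp add: sum_distrib_left g_def mult.left_commute) (rule sum.swap)
      have "(\<Sum>k\<in>UNIV. p k * M (s, a) k) = (\<Sum>s'\<in>UNIV. T s a s' * g s') - g s"
        using sa 1 2 by (simp add: M_def ok_def sum_Plus) (simp add: split)
      with pM[of "(s, a)"] show "(\<Sum>s'\<in>UNIV. T s a s' * g s') \<le> g s" by simp
    qed (use p in \<open>auto simp: g_def\<close>)
    moreover have "(\<Sum>s\<in>UNIV. p (Inl s) * (if s \<in> Z then 0 else - b s)) = - (\<Sum>s\<in>-Z. b s * g s)"
      by (subst split) (simp add: g_def sum_negf mult.commute)
    moreover have "(\<Sum>i\<in>UNIV. p (Inr i) * (\<Sum>j\<in>Z. b j * r i j)) = (\<Sum>j\<in>Z. b j * g j)"
      by (simp add: sum_distrib_left g_def mult.left_commute) (rule sum.swap)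
    ultimately show "(\<Sum>k\<in>UNIV. p k * v k) \<le> 0"
      by (simp add: sum_Plus v_def right_diff_distrib sum_subtractf split[of "\<lambda>s. b s * g s"])
  qed
  then obtain y0 where y0: "\<And>sa. 0 \<le> y0 sa" "\<And>k. v k \<le> (\<Sum>sa\<in>UNIV. y0 sa * M sa k)" by blast
  \<comment> \<open>Where a row of \<open>M\<close> is zeroed by \<open>ok\<close>,
    \<open>y0\<close> may be any nonnegative number. Clearing these entries keeps all sums and makes
    the outflow vanish on \<open>Z\<close> and under disallowed actions.\<close>
  define y where "y = (\<lambda>s a. if ok s a then y0 (s, a) else 0)"
  define Y where "Y = (\<lambda>s. \<Sum>a\<in>UNIV. y s a)"
  have y_nonneg: "0 \<le> y s a" for s a using y0(1) by (simp add: y_def)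
  have yM: "v k \<le> (\<Sum>s\<in>UNIV. \<Sum>a\<in>UNIV. y s a * M (s, a) k)" for k
  proof -
    have "(\<Sum>sa\<in>UNIV. y0 sa * M sa k) = (\<Sum>s\<in>UNIV. \<Sum>a\<in>UNIV. y0 (s, a) * M (s, a) k)"
      by (simp add: sum.cartesian_product)
    also have "\<dots> = (\<Sum>s\<in>UNIV. \<Sum>a\<in>UNIV. y s a * M (s, a) k)"
      by (intro sum.cong refl) (simp add: y_def M_def)
    finally show ?thesis using y0(2)[of k] by simp
  qed
  have inflow: "Y s' - (\<Sum>s\<in>UNIV. \<Sum>a\<in>UNIV. y s a * T s a s') \<le> b s'" if "s' \<notin> Z" for s'
  proof -
    have "(\<Sum>s\<in>UNIV. \<Sum>a\<in>UNIV. y s a * M (s, a) (Inl s'))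
        = (\<Sum>s\<in>UNIV. \<Sum>a\<in>UNIV. y s a * T s a s' - (if s = s' then y s a else 0))"
      using that by (intro sum.cong refl) (auto simp: M_def y_def algebra_simps)
    also have "\<dots> = (\<Sum>s\<in>UNIV. \<Sum>a\<in>UNIV. y s a * T s a s') - (\<Sum>s\<in>UNIV. if s = s' then Y s else 0)"
      unfolding sum_subtractf by (intro arg_cong2[where f = "(-)"] sum.cong refl) (simp add: Y_def)
    finally show ?thesis using yM[of "Inl s'"] that by (simp add: v_def)
  qed
  have gain: "w i - (\<Sum>j\<in>Z. b j * r i j) \<le> (\<Sum>s\<in>UNIV. \<Sum>a\<in>UNIV. y s a * (\<Sum>j\<in>Z. T s a j * r i j))" for i
  proof -
    have "(\<Sum>s\<in>UNIV. \<Sum>a\<in>UNIV. y s a * M (s, a) (Inr i))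
        = (\<Sum>s\<in>UNIV. \<Sum>a\<in>UNIV. y s a * (\<Sum>j\<in>Z. T s a j * r i j))"
      by (intro sum.cong refl) (auto simp: M_def y_def)
    then show ?thesis using yM[of "Inr i"] by (simp add: v_def)
  qed
  \<comment> \<open>The product form also covers states without outflow, where any allowed action
    will do.\<close>
  have "\<exists>q. set_pmf q \<subseteq> A s \<and> (\<forall>a. Y s * pmf q a = y s a)" for s
  proof (cases "Y s = 0")
    case True
    then have "y s a = 0" for a
      using y_nonneg by (simp add: Y_def sum_nonneg_eq_0_iff)
    moreover obtain a where "a \<in> A s" using A_nonempty by blast
    ultimately show ?thesis using True by (intro exI[of _ "return_pmf a"]) simp
  next
    case False
    then have pos: "0 < Y s" using sum_nonneg[of UNIV "y s"] y_nonneg by (simp add: Y_def order_less_le)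
    have pmf: "pmf (embed_pmf (\<lambda>a. y s a / Y s)) a = y s a / Y s" for a
    proof (rule pmf_embed_pmf)
      show "0 \<le> y s x / Y s" for x using pos y_nonneg by simp
      have "(\<Sum>a\<in>UNIV. y s a / Y s) = 1"
        using pos by (simp add: sum_divide_distrib[symmetric] Y_def)
      then show "(\<integral>\<^sup>+ x. ennreal (y s x / Y s) \<partial>count_space UNIV) = 1"
        using pos y_nonneg by (simp add: nn_integral_count_space_finite sum_ennreal)
    qed
    have "a \<in> A s" if "y s a \<noteq> 0" for a
      using that by (simp add: y_def ok_def split: if_splits)
    then show ?thesis
      using pos by (intro exI[of _ "embed_pmf (\<lambda>a. y s a / Y s)"]) (auto simp: pmf set_pmf_eq)
  qed
  then obtain \<sigma> where \<sigma>: "\<And>s. set_pmf (\<sigma> s) \<subseteq> A s" "\<And>s a. Y s * pmf (\<sigma> s) a = y s a" by metis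
  \<comment> \<open>The equations for \<open>f\<close> may have several nonnegative solutions if
    \<sigma> can avoid \<open>Z\<close> forever; the bound covers each of them, in particular the
    reachability probabilities inserted later.\<close>
  have dominates: "w i \<le> (\<Sum>s\<in>UNIV. b s * f s)"
    if f: "\<And>s. s \<notin> Z \<Longrightarrow> 0 \<le> f s"
      "\<And>s. s \<notin> Z \<Longrightarrow> f s = (\<Sum>a\<in>UNIV. pmf (\<sigma> s) a * (\<Sum>s'\<in>UNIV. T s a s' * f s'))"
      "\<And>s. s \<in> Z \<Longrightarrow> f s = r i s" for i f
  proof -
    have Y0: "Y s = 0" if "s \<in> Z" for s using that by (simp add: Y_def y_def ok_def)
    have "(\<Sum>s\<in>-Z. Y s * f s) = (\<Sum>s\<in>UNIV. Y s * f s)"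
      by (simp add: split[of "\<lambda>s. Y s * f s"] Y0)
    also have "\<dots> = (\<Sum>s\<in>UNIV. \<Sum>a\<in>UNIV. y s a * (\<Sum>s'\<in>UNIV. T s a s' * f s'))"
    proof (rule sum.cong[OF refl])
      fix s
      show "Y s * f s = (\<Sum>a\<in>UNIV. y s a * (\<Sum>s'\<in>UNIV. T s a s' * f s'))"
      proof (cases "s \<in> Z")
        case True
        then show ?thesis by (simp add: Y0 y_def ok_def)
      next
        case False
        then show ?thesis
          by (subst f(2)) (simp_all only: sum_distrib_left mult.assoc[symmetric] \<sigma>(2) not_False_eq_True)
      qed
    qed
    \<comment> \<open>Transitions into \<open>Z\<close> earn the reward; exchanging sums turns the
      rest into inflow weighted by \<open>f\<close>.\<close>
    also have "\<dots> = (\<Sum>s\<in>UNIV. \<Sum>a\<in>UNIV. y s a * (\<Sum>j\<in>Z. T s a j * r i j))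
        + (\<Sum>s\<in>UNIV. \<Sum>a\<in>UNIV. y s a * (\<Sum>s'\<in>-Z. T s a s' * f s'))"
      by (simp add: split[of "\<lambda>s'. T _ _ s' * f s'"] f(3) distrib_left sum.distrib)
    also have "(\<Sum>s\<in>UNIV. \<Sum>a\<in>UNIV. y s a * (\<Sum>s'\<in>-Z. T s a s' * f s'))
        = (\<Sum>s'\<in>-Z. (\<Sum>s\<in>UNIV. \<Sum>a\<in>UNIV. y s a * T s a s') * f s')"
    proof -
      have "(\<Sum>s\<in>UNIV. \<Sum>a\<in>UNIV. y s a * (\<Sum>s'\<in>-Z. T s a s' * f s'))
          = (\<Sum>s\<in>UNIV. \<Sum>s'\<in>-Z. \<Sum>a\<in>UNIV. y s a * T s a s' * f s')"
        by (simp add: sum_distrib_left mult.assoc) (intro sum.cong refl sum.swap)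
      also have "\<dots> = (\<Sum>s'\<in>-Z. \<Sum>s\<in>UNIV. \<Sum>a\<in>UNIV. y s a * T s a s' * f s')"
        by (rule sum.swap)
      finally show ?thesis by (simp add: sum_distrib_right)
    qed
    finally have "(\<Sum>s'\<in>-Z. (Y s' - (\<Sum>s\<in>UNIV. \<Sum>a\<in>UNIV. y s a * T s a s')) * f s')
        = (\<Sum>s\<in>UNIV. \<Sum>a\<in>UNIV. y s a * (\<Sum>j\<in>Z. T s a j * r i j))"
      by (simp add: left_diff_distrib sum_subtractf)
    moreover have "(\<Sum>s'\<in>-Z. (Y s' - (\<Sum>s\<in>UNIV. \<Sum>a\<in>UNIV. y s a * T s a s')) * f s') \<le> (\<Sum>s'\<in>-Z. b s' * f s')"
      using f(1) inflow by (intro sum_mono mult_right_mono) auto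
    ultimately show ?thesis using gain[of i] by (simp add: split[of "\<lambda>s. b s * f s"] f(3))
  qed
  from \<sigma>(1) dominates show thesis by (rule that)
qed

end

section \<open>Reachability probabilities\<close>

abbreviation shift_policy :: "'s \<Rightarrow> 'a \<Rightarrow> ('s, 'a) policy \<Rightarrow> ('s, 'a) policy" where
  "shift_policy s a \<pi> \<equiv> \<lambda>h. \<pi> ((s, a) # h)"

text \<open>First-step analysis for a visit at one of the times \<open>t < n\<close>. With
  \<open>n = 0\<close> no state is inspected, so the value is 0 even on \<open>Y\<close>.\<close>

fun hit_within :: "('s::finite \<Rightarrow> 'a::finite \<Rightarrow> 's \<Rightarrow> real) \<Rightarrow> 's set \<Rightarrow> nat \<Rightarrow> ('s, 'a) policy \<Rightarrow> 's \<Rightarrow> real" where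
  "hit_within T Y 0 \<pi> s = 0"
| "hit_within T Y (Suc n) \<pi> s = (if s \<in> Y then 1 else
    \<Sum>a\<in>UNIV. pmf (\<pi> [] s) a * (\<Sum>s'\<in>UNIV. T s a s' * hit_within T Y n (shift_policy s a \<pi>) s'))"

section \<open>Probabilities of finite trajectory prefixes\<close>

definition prefix_prob :: "('s::finite \<Rightarrow> 'a::finite \<Rightarrow> 's \<Rightarrow> real) \<Rightarrow> 's pmf \<Rightarrow> ('s, 'a) policy \<Rightarrow> ('s \<times> 'a) list \<Rightarrow> real" where
  "prefix_prob T \<beta> \<pi> xs = (\<Prod>i<length xs. pmf (step_pmf T \<beta> \<pi> i ((!) xs)) (xs ! i))"

lemma map_upt_length_eq_iff: "map \<omega> [0..<length xs] = xs \<longleftrightarrow> (\<forall>i<length xs. \<omega> i = xs ! i)"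
  by (subst list_eq_iff_nth_eq) simp

lemma emeasure_trajectory_prefix:
  "emeasure (trajectory_measure T \<beta> \<pi>) {\<omega>. map \<omega> [0..<length xs] = xs} = ennreal (prefix_prob T \<beta> \<pi> xs)"
  by (simp add: map_upt_length_eq_iff emeasure_trajectory_cylinder prefix_prob_def)

lemma pmf_bind_map_Pair: "pmf (bind_pmf p (\<lambda>s. map_pmf (Pair s) (q s))) (s, a) = pmf p s * pmf (q s) a"
proof -
  have "pmf (map_pmf (Pair s') (q s')) (s, a) = pmf (q s) a * indicator {s} s'" for s'
  proof (cases "s' = s")
    case True
    then show ?thesis by (simp add: pmf_map_inj' inj_on_def)
  next
    case False
    then have "(s, a) \<notin> Pair s' ` set_pmf (q s')" by auto
    then show ?thesis using False by (simp add: pmf_eq_0_set_pmf)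
  qed
  then show ?thesis by (simp add: pmf_bind measure_pmf_single)
qed

text \<open>For \<open>i = 0\<close> the transition out of \<open>(s, a)\<close> turns into the
  initial distribution of the shifted process; for later \<open>i\<close> both sides read the same
  preceding pair.\<close>

lemma step_pmf_Suc_Cons:
  "step_pmf T \<beta> \<pi> (Suc i) ((!) ((s, a) # xs)) = step_pmf T (embed_pmf (T s a)) (shift_policy s a \<pi>) i ((!) xs)"
proof -
  have "map ((!) ((s, a) # xs)) [0..<Suc i] = (s, a) # map ((!) xs) [0..<i]"
    by (simp add: map_upt_Suc del: upt_Suc)
  then show ?thesis by (cases i) (simp_all add: step_pmf_def del: upt_Suc)
qed

lemma prefix_prob_Nil [simp]: "prefix_prob T \<beta> \<pi> [] = 1"
  by (simp add: prefix_prob_def)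

text \<open>Conditioning on the first pair becomes a splitting of a finite product when done on
  prefixes instead of infinite trajectories.\<close>

lemma prefix_prob_Cons:
  "prefix_prob T \<beta> \<pi> ((s, a) # xs)
    = pmf \<beta> s * pmf (\<pi> [] s) a * prefix_prob T (embed_pmf (T s a)) (shift_policy s a \<pi>) xs"
proof -
  have "pmf (step_pmf T \<beta> \<pi> 0 ((!) ((s, a) # xs))) (s, a) = pmf \<beta> s * pmf (\<pi> [] s) a"
    by (simp add: step_pmf_def pmf_bind_map_Pair)
  then show ?thesis
    by (simp add: prefix_prob_def prod.lessThan_Suc_shift step_pmf_Suc_Cons del: prod.lessThan_Suc)
qed

lemma prefix_prob_nonneg: "0 \<le> prefix_prob T \<beta> \<pi> xs"
  by (simp add: prefix_prob_def prod_nonneg)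

lemma space_trajectory_measure: "space (trajectory_measure T \<beta> \<pi>) = UNIV"
  using sets_eq_imp_space_eq[OF sets_trajectory_measure[of T \<beta> \<pi>]] by (simp add: space_PiM)

lemma prob_space_trajectory_measure: "prob_space (trajectory_measure T \<beta> \<pi>)"
  using emeasure_trajectory_cylinder[of T \<beta> \<pi> 0 undefined]
  by (intro prob_spaceI) (simp add: space_trajectory_measure)

lemma sets_prefix:
  "{\<omega>. map \<omega> [0..<n] = xs} \<in> sets (trajectory_measure T \<beta> \<pi>)"
proof (cases "length xs = n")
  case True
  have "Measurable.pred (PiM UNIV (\<lambda>_. count_space UNIV)) (\<lambda>\<omega>. \<forall>i\<in>{..<n}. \<omega> i = xs ! i)"
    by (rule pred_intros_finite(3)[OF finite_lessThan])
      (rule measurable_compose[OF measurable_component_singleton], auto)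
  moreover have "{\<omega>. map \<omega> [0..<n] = xs} = {\<omega>. \<forall>i\<in>{..<n}. \<omega> i = xs ! i}"
    using True map_upt_length_eq_iff[of _ xs] by auto
  ultimately show ?thesis
    by (simp add: pred_def space_PiM sets_trajectory_measure)
next
  case False
  then have "{\<omega>. map \<omega> [0..<n] = xs} = {}" by auto
  then show ?thesis by simp
qed

lemma finite_lists_length: "finite {xs :: 'a::finite list. length xs = n \<and> P xs}"
  using finite_lists_length_eq[of UNIV n] by (rule rev_finite_subset) auto

lemma prefix_property_eq_UN:
  "{\<omega>. P (map \<omega> [0..<n])} = (\<Union>xs\<in>{xs. length xs = n \<and> P xs}. {\<omega>. map \<omega> [0..<n] = xs})"
  by auto

lemma sets_prefix_property: "{\<omega>. P (map \<omega> [0..<n])} \<in> sets (trajectory_measure T \<beta> \<pi>)"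
  unfolding prefix_property_eq_UN by (intro sets.finite_UN finite_lists_length sets_prefix)

text \<open>There are finitely many state-action pairs, so an event about the first \<open>n\<close>
  of them is a finite disjoint union of cylinders.\<close>

lemma measure_prefix_property:
  "measure (trajectory_measure T \<beta> \<pi>) {\<omega>. P (map \<omega> [0..<n])}
    = (\<Sum>xs | length xs = n \<and> P xs. prefix_prob T \<beta> \<pi> xs)"
proof -
  interpret prob_space "trajectory_measure T \<beta> \<pi>" by (rule prob_space_trajectory_measure)
  let ?L = "{xs. length xs = n \<and> P xs}"
  have "prob {\<omega>. P (map \<omega> [0..<n])} = (\<Sum>xs\<in>?L. prob {\<omega>. map \<omega> [0..<n] = xs})"
    unfolding prefix_property_eq_UN
    by (intro finite_measure_finite_Union finite_lists_length)
      (auto simp: sets_prefix disjoint_family_on_def)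
  also have "\<dots> = (\<Sum>xs\<in>?L. prefix_prob T \<beta> \<pi> xs)"
    using emeasure_trajectory_prefix[of T \<beta> \<pi>]
    by (intro sum.cong refl) (auto simp: measure_def prefix_prob_nonneg)
  finally show ?thesis .
qed

lemma sum_lists_Suc:
  fixes g :: "('s::finite \<times> 'a::finite) list \<Rightarrow> real"
  shows "(\<Sum>xs | length xs = Suc n \<and> P xs. g xs)
    = (\<Sum>s\<in>UNIV. \<Sum>a\<in>UNIV. \<Sum>xs | length xs = n \<and> P ((s, a) # xs). g ((s, a) # xs))"
proof -
  let ?L = "\<lambda>x. {xs. length xs = n \<and> P (x # xs)}"
  have "{xs. length xs = Suc n \<and> P xs} = (\<lambda>(x, xs). x # xs) ` (SIGMA x:UNIV. ?L x)"
    by (force simp: length_Suc_conv)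
  then have "(\<Sum>xs | length xs = Suc n \<and> P xs. g xs) = (\<Sum>(x, xs)\<in>(SIGMA x:UNIV. ?L x). g (x # xs))"
    by (simp add: sum.reindex inj_on_def case_prod_beta)
  also have "\<dots> = (\<Sum>x\<in>UNIV. \<Sum>xs\<in>?L x. g (x # xs))"
    by (subst sum.Sigma) (auto intro: finite_lists_length)
  also have "\<dots> = (\<Sum>s\<in>UNIV. \<Sum>a\<in>UNIV. \<Sum>xs\<in>?L (s, a). g ((s, a) # xs))"
    by (simp add: sum.cartesian_product)
  finally show ?thesis .
qed

lemma is_policy_shift: "is_policy A \<pi> \<Longrightarrow> is_policy A (shift_policy s a \<pi>)"
  by (simp add: is_policy_def)

abbreviation reach_from ::
  "('s::finite \<Rightarrow> 'a::finite \<Rightarrow> 's \<Rightarrow> real) \<Rightarrow> 's set \<Rightarrow> ('s, 'a) policy \<Rightarrow> 's \<Rightarrow> real" where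
  "reach_from T Y \<pi> s \<equiv> prob_reach T (return_pmf s) \<pi> Y"

lemma prob_reach_nonneg: "0 \<le> prob_reach T \<beta> \<pi> Y"
  by (simp add: prob_reach_def)

lemma prob_reach_le_1: "prob_reach T \<beta> \<pi> Y \<le> 1"
  using prob_space.prob_le_1[OF prob_space_trajectory_measure] by (simp add: prob_reach_def)

section \<open>First-step equations, passage to the limit, and superharmonic bounds\<close>

context finite_mdp
begin

lemma sum_prefix_prob_hitting:
  assumes "is_policy A \<pi>"
  shows "(\<Sum>xs | length xs = n \<and> (\<exists>x\<in>set xs. fst x \<in> Y). prefix_prob T \<beta> \<pi> xs)
    = (\<Sum>s\<in>UNIV. pmf \<beta> s * hit_within T Y n \<pi> s)"
  using assms
proof (induction n arbitrary: \<beta> \<pi>)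
  case 0
  have "{xs :: ('s \<times> 'a) list. length xs = 0 \<and> (\<exists>x\<in>set xs. fst x \<in> Y)} = {}" by auto
  then show ?case by simp
next
  case (Suc n)
  have tail: "(\<Sum>xs | length xs = n \<and> (\<exists>x\<in>set ((s, a) # xs). fst x \<in> Y). prefix_prob T \<beta> \<pi> ((s, a) # xs))
      = pmf \<beta> s * (pmf (\<pi> [] s) a * (if s \<in> Y then 1
          else \<Sum>s'\<in>UNIV. T s a s' * hit_within T Y n (shift_policy s a \<pi>) s'))" for s a
  proof -
    \<comment> \<open>Once \<open>s\<close> lies in \<open>Y\<close>, every continuation counts, and
      their probabilities add up to 1.\<close>
    have total: "(\<Sum>xs | length xs = n. prefix_prob T \<beta>' \<pi>' xs) = 1" for \<beta>' \<pi>'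
      using measure_prefix_property[of T \<beta>' \<pi>' "\<lambda>_. True" n]
        prob_space.prob_space[OF prob_space_trajectory_measure[of T \<beta>' \<pi>']]
      by (simp add: space_trajectory_measure)
    \<comment> \<open>For a disallowed action \<open>embed_pmf (T s a)\<close> is unspecified, but
      there the policy puts weight zero.\<close>
    have T: "pmf (\<pi> [] s) a * (\<Sum>s'\<in>UNIV. pmf (embed_pmf (T s a)) s' * h s')
        = pmf (\<pi> [] s) a * (\<Sum>s'\<in>UNIV. T s a s' * h s')" for h
    proof (cases "a \<in> A s")
      case True
      then show ?thesis by (simp add: pmf_embed_T)
    next
      case False
      then have "pmf (\<pi> [] s) a = 0" using Suc.prems by (auto simp: is_policy_def set_pmf_eq)
      then show ?thesis by simp
    qed
    show ?thesis
      using Suc.IH[OF is_policy_shift[OF Suc.prems], of "embed_pmf (T s a)" s a]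
      T[of "hit_within T Y n (shift_policy s a \<pi>)"]
      by (simp add: prefix_prob_Cons sum_distrib_left[symmetric] total mult.assoc)
  qed
  have "(\<Sum>xs | length xs = Suc n \<and> (\<exists>x\<in>set xs. fst x \<in> Y). prefix_prob T \<beta> \<pi> xs)
      = (\<Sum>s\<in>UNIV. pmf \<beta> s * (\<Sum>a\<in>UNIV. pmf (\<pi> [] s) a * (if s \<in> Y then 1
          else \<Sum>s'\<in>UNIV. T s a s' * hit_within T Y n (shift_policy s a \<pi>) s')))"
    by (subst sum_lists_Suc) (simp only: tail sum_distrib_left)
  also have "\<dots> = (\<Sum>s\<in>UNIV. pmf \<beta> s * hit_within T Y (Suc n) \<pi> s)"
    by (intro sum.cong refl arg_cong2[where f = "(*)"]) (simp add: sum_pmf_eq_1)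
  finally show ?case .
qed

lemma ex_less_iff_prefix: "(\<exists>t<n. P (\<omega> t)) \<longleftrightarrow> (\<exists>x\<in>set (map \<omega> [0..<n]). P x)"
  by (simp add: atLeast0LessThan) (metis lessThan_iff)

lemma measure_hit_within:
  assumes "is_policy A \<pi>"
  shows "measure (trajectory_measure T \<beta> \<pi>) {\<omega>. \<exists>t<n. fst (\<omega> t) \<in> Y}
    = (\<Sum>s\<in>UNIV. pmf \<beta> s * hit_within T Y n \<pi> s)"
  using measure_prefix_property[of T \<beta> \<pi> "\<lambda>xs. \<exists>x\<in>set xs. fst x \<in> Y" n]
    sum_prefix_prob_hitting[OF assms, where \<beta> = \<beta> and n = n and Y = Y]
  by (simp only: ex_less_iff_prefix[where P = "\<lambda>x. fst x \<in> Y"])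

text \<open>Continuity from below along the increasing events of a visit before time
  \<open>n\<close>.\<close>

lemma hit_within_tendsto_prob_reach:
  assumes "is_policy A \<pi>"
  shows "(\<lambda>n. \<Sum>s\<in>UNIV. pmf \<beta> s * hit_within T Y n \<pi> s) \<longlonglongrightarrow> prob_reach T \<beta> \<pi> Y"
proof -
  interpret prob_space "trajectory_measure T \<beta> \<pi>" by (rule prob_space_trajectory_measure)
  let ?H = "\<lambda>n. {\<omega> :: nat \<Rightarrow> 's \<times> 'a. \<exists>t<n. fst (\<omega> t) \<in> Y}"
  have "?H n \<in> events" for n
    using sets_prefix_property[of "\<lambda>xs. \<exists>x\<in>set xs. fst x \<in> Y" n T \<beta> \<pi>]
    by (simp only: ex_less_iff_prefix[where P = "\<lambda>x. fst x \<in> Y"])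
  moreover have "incseq ?H" by (force simp: incseq_def)
  ultimately have "(\<lambda>n. prob (?H n)) \<longlonglongrightarrow> prob (\<Union>n. ?H n)"
    by (intro finite_Lim_measure_incseq) auto
  moreover have "(\<Union>n. ?H n) = {\<omega>. \<exists>t. fst (\<omega> t) \<in> Y}" by auto
  ultimately show ?thesis by (simp add: measure_hit_within[OF assms] prob_reach_def)
qed

lemma hit_within_tendsto:
  assumes "is_policy A \<pi>"
  shows "(\<lambda>n. hit_within T Y n \<pi> s) \<longlonglongrightarrow> reach_from T Y \<pi> s"
  using hit_within_tendsto_prob_reach[OF assms, of "return_pmf s" Y] by (simp add: indicator_def)

lemma prob_reach_eq_sum:
  assumes "is_policy A \<pi>"
  shows "prob_reach T \<beta> \<pi> Y = (\<Sum>s\<in>UNIV. pmf \<beta> s * reach_from T Y \<pi> s)"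
  by (rule LIMSEQ_unique[OF hit_within_tendsto_prob_reach[OF assms]])
    (intro tendsto_intros hit_within_tendsto assms)

text \<open>Limit of the recursion for \<open>hit_within\<close>; the sums are finite, so limits
  pass through them.\<close>

lemma reach_from_eq:
  assumes "is_policy A \<pi>"
  shows "reach_from T Y \<pi> s = (if s \<in> Y then 1 else
    \<Sum>a\<in>UNIV. pmf (\<pi> [] s) a * (\<Sum>s'\<in>UNIV. T s a s' * reach_from T Y (shift_policy s a \<pi>) s'))"
proof (rule LIMSEQ_unique[OF LIMSEQ_Suc[OF hit_within_tendsto[OF assms]]])
  show "(\<lambda>n. hit_within T Y (Suc n) \<pi> s) \<longlonglongrightarrow> (if s \<in> Y then 1 else
    \<Sum>a\<in>UNIV. pmf (\<pi> [] s) a * (\<Sum>s'\<in>UNIV. T s a s' * reach_from T Y (shift_policy s a \<pi>) s'))"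
    using hit_within_tendsto[OF is_policy_shift[OF assms]] by (auto intro!: tendsto_intros)
qed

lemma hit_within_le_reach_from:
  assumes "is_policy A \<pi>"
  shows "hit_within T Y n \<pi> s \<le> reach_from T Y \<pi> s"
proof -
  interpret prob_space "trajectory_measure T (return_pmf s) \<pi>" by (rule prob_space_trajectory_measure)
  have "hit_within T Y n \<pi> s = prob {\<omega>. \<exists>t<n. fst (\<omega> t) \<in> Y}"
    by (simp add: measure_hit_within[OF assms] indicator_def)
  also have "\<dots> \<le> reach_from T Y \<pi> s"
    unfolding prob_reach_def by (rule finite_measure_mono[OF _ sets_reach]) auto
  finally show ?thesis .
qed

text \<open>Weak duality, by induction on the horizon for all policies at once, since a step
  replaces the policy by its shift. Off \<open>Z\<close> superharmonicity absorbs the step; on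
  \<open>Z\<close> the bound \<open>g_Z\<close> ends the recursion.\<close>

lemma weighted_reach_le_superharmonic:
  fixes l :: "'i::finite \<Rightarrow> real" and Y :: "'i \<Rightarrow> 's set"
  assumes l: "\<And>i. 0 \<le> l i" and Y: "\<And>i. Y i \<subseteq> Z"
    and g_nonneg: "\<And>s. s \<notin> Z \<Longrightarrow> 0 \<le> g s"
    and g_Z: "\<And>s \<pi>. s \<in> Z \<Longrightarrow> is_policy A \<pi> \<Longrightarrow> (\<Sum>i\<in>UNIV. l i * reach_from T (Y i) \<pi> s) \<le> g s"
    and g_super: "\<And>s a. s \<notin> Z \<Longrightarrow> a \<in> A s \<Longrightarrow> (\<Sum>s'\<in>UNIV. T s a s' * g s') \<le> g s"
    and "is_policy A \<pi>"
  shows "(\<Sum>i\<in>UNIV. l i * reach_from T (Y i) \<pi> s) \<le> g s"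
proof -
  have "(\<Sum>i\<in>UNIV. l i * hit_within T (Y i) n \<pi> s) \<le> g s" for n
    using \<open>is_policy A \<pi>\<close>
  proof (induction n arbitrary: \<pi> s)
    case (Suc n)
    show ?case
    proof (cases "s \<in> Z")
      case True
      have "(\<Sum>i\<in>UNIV. l i * hit_within T (Y i) (Suc n) \<pi> s) \<le> (\<Sum>i\<in>UNIV. l i * reach_from T (Y i) \<pi> s)"
        by (intro sum_mono mult_left_mono hit_within_le_reach_from l Suc.prems)
      also have "\<dots> \<le> g s" by (rule g_Z[OF True Suc.prems])
      finally show ?thesis .
    next
      case False
      let ?h = "\<lambda>i a s'. hit_within T (Y i) n (shift_policy s a \<pi>) s'"
      \<comment> \<open>Off \<open>Z\<close> no target is hit, so all recursions take the same step
        and the weighted sum can be moved inside.\<close>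
      have "(\<Sum>i\<in>UNIV. l i * hit_within T (Y i) (Suc n) \<pi> s)
          = (\<Sum>i\<in>UNIV. \<Sum>a\<in>UNIV. \<Sum>s'\<in>UNIV. pmf (\<pi> [] s) a * (T s a s' * (l i * ?h i a s')))"
        using False Y by (intro sum.cong refl) (auto simp: sum_distrib_left mult_ac)
      also have "\<dots> = (\<Sum>a\<in>UNIV. \<Sum>i\<in>UNIV. \<Sum>s'\<in>UNIV. pmf (\<pi> [] s) a * (T s a s' * (l i * ?h i a s')))"
        by (rule sum.swap)
      also have "\<dots> = (\<Sum>a\<in>UNIV. \<Sum>s'\<in>UNIV. \<Sum>i\<in>UNIV. pmf (\<pi> [] s) a * (T s a s' * (l i * ?h i a s')))"
        by (intro sum.cong refl sum.swap)
      also have "\<dots> = (\<Sum>a\<in>UNIV. pmf (\<pi> [] s) a * (\<Sum>s'\<in>UNIV. T s a s' * (\<Sum>i\<in>UNIV. l i * ?h i a s')))"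
        by (simp only: sum_distrib_left)
      also have "\<dots> \<le> (\<Sum>a\<in>UNIV. pmf (\<pi> [] s) a * g s)"
      proof (rule sum_mono)
        fix a
        show "pmf (\<pi> [] s) a * (\<Sum>s'\<in>UNIV. T s a s' * (\<Sum>i\<in>UNIV. l i * ?h i a s')) \<le> pmf (\<pi> [] s) a * g s"
        proof (cases "a \<in> A s")
          case True
          have "(\<Sum>s'\<in>UNIV. T s a s' * (\<Sum>i\<in>UNIV. l i * ?h i a s')) \<le> (\<Sum>s'\<in>UNIV. T s a s' * g s')"
            by (intro sum_mono mult_left_mono Suc.IH is_policy_shift Suc.prems T_nonneg)
          also have "\<dots> \<le> g s" by (rule g_super[OF False True])
          finally show ?thesis by (rule mult_left_mono) simp
        next
          case False
          then have "pmf (\<pi> [] s) a = 0" using Suc.prems by (auto simp: is_policy_def set_pmf_eq)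
          then show ?thesis by simp
        qed
      qed
      also have "\<dots> = g s"
        by (simp add: sum_distrib_right[symmetric] sum_pmf_eq_1)
      finally show ?thesis .
    qed
  next
    case 0
    show ?case
    proof (cases "s \<in> Z")
      case True
      \<comment> \<open>\<open>g_nonneg\<close> covers only states off \<open>Z\<close>; on
        \<open>Z\<close> the sign of \<open>g\<close> comes from \<open>g_Z\<close>.\<close>
      have "0 \<le> (\<Sum>i\<in>UNIV. l i * reach_from T (Y i) \<pi> s)"
        by (intro sum_nonneg mult_nonneg_nonneg l prob_reach_nonneg)
      also have "\<dots> \<le> g s" by (rule g_Z[OF True 0])
      finally show ?thesis by simp
    qed (simp add: g_nonneg)
  qed
  moreover have "(\<lambda>n. \<Sum>i\<in>UNIV. l i * hit_within T (Y i) n \<pi> s) \<longlonglongrightarrow> (\<Sum>i\<in>UNIV. l i * reach_from T (Y i) \<pi> s)"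
    by (intro tendsto_intros hit_within_tendsto \<open>is_policy A \<pi>\<close>)
  ultimately show ?thesis by (intro LIMSEQ_le_const2) auto
qed

section \<open>Optimal and switching policies\<close>

text \<open>Unit mass at every state makes one inequality control all starts: the total value of the
  policy found is at least the sum of the suprema \<open>V s\<close>, none of which it can exceed,
  so all are attained.\<close>

lemma ex_stationary_maximizes_reach:
  "\<exists>\<rho>. is_stationary_policy A \<rho> \<and> maximizes_reach A T Y \<rho>"
proof -
  define V where "V = (\<lambda>s. SUP \<pi>\<in>{\<pi>. is_policy A \<pi>}. reach_from T Y \<pi> s)"
  have bdd: "bdd_above ((\<lambda>\<pi>. reach_from T Y \<pi> s) ` {\<pi>. is_policy A \<pi>})" for s
    by (intro bdd_aboveI2[where M = 1] prob_reach_le_1)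
  have le_V: "reach_from T Y \<pi> s \<le> V s" if "is_policy A \<pi>" for \<pi> s
    unfolding V_def using that by (intro cSUP_upper bdd) auto
  have "\<exists>\<pi>. is_policy A \<pi>"
    using A_nonempty
    by (intro exI[of _ "\<lambda>_ s. return_pmf (SOME a. a \<in> A s)"]) (auto simp: is_policy_def some_in_eq)
  then have V_le: "V s \<le> c" if "\<And>\<pi>. is_policy A \<pi> \<Longrightarrow> reach_from T Y \<pi> s \<le> c" for s c
    unfolding V_def using that by (intro cSUP_least) auto
  have dual: "(\<Sum>i\<in>UNIV. l i * (\<Sum>s\<in>UNIV. V s)) \<le> (\<Sum>s\<in>UNIV. 1 * g s)"
    if l: "\<And>i. 0 \<le> l i" and g: "\<And>s. s \<notin> Y \<Longrightarrow> 0 \<le> g s"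
      "\<And>s. s \<in> Y \<Longrightarrow> g s = (\<Sum>i\<in>UNIV. l i * 1)"
      "\<And>s a. s \<notin> Y \<Longrightarrow> a \<in> A s \<Longrightarrow> (\<Sum>s'\<in>UNIV. T s a s' * g s') \<le> g s"
    for l :: "unit \<Rightarrow> real" and g
  proof -
    have reach_le: "l () * reach_from T Y \<pi> s \<le> g s" if "is_policy A \<pi>" for \<pi> s
    proof -
      have "(\<Sum>i\<in>(UNIV :: unit set). l i * reach_from T Y \<pi> s) \<le> g s"
      proof (rule weighted_reach_le_superharmonic[where Z = Y and Y = "\<lambda>_. Y"])
        fix s \<rho> assume "s \<in> Y"
        then show "(\<Sum>i\<in>UNIV. l i * reach_from T Y \<rho> s) \<le> g s"
          by (simp only: g(2)) (intro sum_mono mult_left_mono prob_reach_le_1 l)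
      qed (use l g that in auto)
      then show ?thesis by (simp add: UNIV_unit)
    qed
    have "l () * V s \<le> g s" for s
    \<comment> \<open>A positive weight can be divided out to compare \<open>g\<close> with the
      supremum; for weight zero only \<open>0 \<le> g s\<close> is left.\<close>
    proof (cases "l () = 0")
      case True
      then show ?thesis using g(1,2)[of s] by (cases "s \<in> Y") (auto simp: UNIV_unit)
    next
      case False
      then have pos: "0 < l ()" using l[of "()"] by simp
      then have "V s \<le> g s / l ()"
        using reach_le by (intro V_le) (simp add: pos_le_divide_eq mult.commute)
      then show ?thesis using pos by (simp add: pos_le_divide_eq mult.commute)
    qed
    then show ?thesis
      by (simp add: UNIV_unit sum_distrib_left sum_mono)
  qed
  show ?thesis
  proof (rule ex_stationary_dominating[where Z = Y and r = "\<lambda>_ _. 1" and w = "\<lambda>_. \<Sum>s\<in>UNIV. V s" and b = "\<lambda>_. 1", OF dual])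
    fix \<sigma> assume \<sigma>: "\<And>s. set_pmf (\<sigma> s) \<subseteq> A s"
      and dom: "\<And>(i :: unit) f. (\<And>s. s \<notin> Y \<Longrightarrow> 0 \<le> f s) \<Longrightarrow>
        (\<And>s. s \<notin> Y \<Longrightarrow> f s = (\<Sum>a\<in>UNIV. pmf (\<sigma> s) a * (\<Sum>s'\<in>UNIV. T s a s' * f s'))) \<Longrightarrow>
        (\<And>s. s \<in> Y \<Longrightarrow> f s = 1) \<Longrightarrow> (\<Sum>s\<in>UNIV. V s) \<le> (\<Sum>s\<in>UNIV. 1 * f s)"
    define \<rho> :: "('s, 'a) policy" where "\<rho> = (\<lambda>_. \<sigma>)"
    have pol: "is_policy A \<rho>" using \<sigma> by (simp add: is_policy_def \<rho>_def)
    have "(\<Sum>s\<in>UNIV. V s) \<le> (\<Sum>s\<in>UNIV. 1 * reach_from T Y \<rho> s)"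
    proof (rule dom)
      fix s assume "s \<notin> Y"
      then show "reach_from T Y \<rho> s = (\<Sum>a\<in>UNIV. pmf (\<sigma> s) a * (\<Sum>s'\<in>UNIV. T s a s' * reach_from T Y \<rho> s'))"
        by (subst reach_from_eq[OF pol]) (simp add: \<rho>_def)
    next
      fix s assume "s \<in> Y"
      then show "reach_from T Y \<rho> s = 1" by (simp add: reach_from_eq[OF pol])
    qed (rule prob_reach_nonneg)
    then have "(\<Sum>s\<in>UNIV. V s - reach_from T Y \<rho> s) \<le> 0" by (simp add: sum_subtractf)
    moreover have "V s - reach_from T Y \<rho> s \<le> (\<Sum>s\<in>UNIV. V s - reach_from T Y \<rho> s)" for s
      using le_V[OF pol] by (intro member_le_sum) auto
    ultimately have V_rho: "V s \<le> reach_from T Y \<rho> s" for s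
      by (smt (verit))
    have "reach_from T Y \<pi> s \<le> reach_from T Y \<rho> s" if "is_policy A \<pi>" for \<pi> s
      using le_V[OF that] V_rho by (rule order_trans)
    then have "maximizes_reach A T Y \<rho>"
      using pol by (simp add: maximizes_reach_def)
    moreover have "is_stationary_policy A \<rho>" using pol by (simp add: is_stationary_policy_def \<rho>_def)
    ultimately show ?thesis by blast
  qed
qed

end

text \<open>The choices left open after both sets are visited are settled by keeping forever the
  policy selected at the first visit; a first visit to both sets counts as one to
  \<open>Z\<phi>\<close>.\<close>

definition switching_policy ::
  "'s set \<Rightarrow> 's set \<Rightarrow> ('s, 'a) policy \<Rightarrow> ('s, 'a) policy \<Rightarrow> ('s, 'a) policy \<Rightarrow> ('s, 'a) policy" where
  "switching_policy Z\<phi> Z\<psi> \<pi>mix \<pi>\<psi> \<pi>\<phi> h s = (case find (\<lambda>x. x \<in> Z\<phi> \<union> Z\<psi>) (map fst h @ [s]) of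
      None \<Rightarrow> \<pi>mix h s
    | Some j \<Rightarrow> if j \<in> Z\<phi> then \<pi>\<psi> h s else \<pi>\<phi> h s)"

theorem theorem2:
  fixes A :: "'s::finite \<Rightarrow> 'a::finite set"
    and T :: "'s \<Rightarrow> 'a \<Rightarrow> 's \<Rightarrow> real"
    and \<beta> :: "'s pmf"
    and Z\<phi> Z\<psi> :: "'s set"
    and \<pi> :: "('s, 'a) policy"
  assumes "finite_mdp A T"
    and "is_policy A \<pi>"
  shows "\<exists>\<pi>ss. is_switching_policy A T Z\<phi> Z\<psi> \<pi>ss \<and>
    prob_reach T \<beta> \<pi>ss Z\<phi> \<ge> prob_reach T \<beta> \<pi> Z\<phi> \<and>
    prob_reach T \<beta> \<pi>ss Z\<psi> \<ge> prob_reach T \<beta> \<pi> Z\<psi>"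
proof -
  interpret finite_mdp A T by fact
  define Z where "Z = Z\<phi> \<union> Z\<psi>"
  obtain \<pi>\<phi> where \<pi>\<phi>: "is_stationary_policy A \<pi>\<phi>" "maximizes_reach A T Z\<phi> \<pi>\<phi>"
    using ex_stationary_maximizes_reach by blast
  obtain \<pi>\<psi> where \<pi>\<psi>: "is_stationary_policy A \<pi>\<psi>" "maximizes_reach A T Z\<psi> \<pi>\<psi>"
    using ex_stationary_maximizes_reach by blast
  define target where "target = (\<lambda>i. if i then Z\<phi> else Z\<psi>)"
  define opt where "opt = (\<lambda>i. if i then \<pi>\<phi> else \<pi>\<psi>)"
  have opt_policy: "is_policy A (opt i)" for i
    using \<pi>\<phi>(2) \<pi>\<psi>(2) by (simp add: opt_def maximizes_reach_def)
  have opt_stat: "opt i h = opt i h'" for i h h'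
    using \<pi>\<phi>(1) \<pi>\<psi>(1) by (auto simp: opt_def is_stationary_policy_def fun_eq_iff)
  have opt_max: "reach_from T (target i) \<rho> s \<le> reach_from T (target i) (opt i) s"
    if "is_policy A \<rho>" for i \<rho> s
    using \<pi>\<phi>(2) \<pi>\<psi>(2) that by (simp add: opt_def target_def maximizes_reach_def)
  have dual: "(\<Sum>i\<in>UNIV. l i * prob_reach T \<beta> \<pi> (target i)) \<le> (\<Sum>s\<in>UNIV. pmf \<beta> s * g s)"
    if l: "\<And>i. 0 \<le> l i" and g: "\<And>s. s \<notin> Z \<Longrightarrow> 0 \<le> g s"
      "\<And>s. s \<in> Z \<Longrightarrow> g s = (\<Sum>i\<in>UNIV. l i * reach_from T (target i) (opt i) s)"
      "\<And>s a. s \<notin> Z \<Longrightarrow> a \<in> A s \<Longrightarrow> (\<Sum>s'\<in>UNIV. T s a s' * g s') \<le> g s"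
    for l g
  proof -
    have "(\<Sum>i\<in>UNIV. l i * reach_from T (target i) \<pi> s) \<le> g s" for s
    proof (rule weighted_reach_le_superharmonic[where Z = Z and Y = target])
      fix s \<rho> assume "s \<in> Z" "is_policy A \<rho>"
      then show "(\<Sum>i\<in>UNIV. l i * reach_from T (target i) \<rho> s) \<le> g s"
        by (simp only: g(2)) (intro sum_mono mult_left_mono opt_max l)
    qed (use l g assms(2) in \<open>auto simp: Z_def target_def\<close>)
    then have "(\<Sum>s\<in>UNIV. pmf \<beta> s * (\<Sum>i\<in>UNIV. l i * reach_from T (target i) \<pi> s)) \<le> (\<Sum>s\<in>UNIV. pmf \<beta> s * g s)"
      by (intro sum_mono mult_left_mono) auto
    moreover have "(\<Sum>i\<in>UNIV. l i * prob_reach T \<beta> \<pi> (target i))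
        = (\<Sum>s\<in>UNIV. pmf \<beta> s * (\<Sum>i\<in>UNIV. l i * reach_from T (target i) \<pi> s))"
      unfolding prob_reach_eq_sum[OF assms(2), of \<beta>] sum_distrib_left
      by (subst sum.swap) (simp only: mult.left_commute)
    ultimately show ?thesis
      by simp
  qed
  show ?thesis
  proof (rule ex_stationary_dominating[where Z = Z and r = "\<lambda>i. reach_from T (target i) (opt i)"
        and w = "\<lambda>i. prob_reach T \<beta> \<pi> (target i)" and b = "pmf \<beta>", OF dual])
    fix \<sigma> assume \<sigma>: "\<And>s. set_pmf (\<sigma> s) \<subseteq> A s"
      and dom: "\<And>i f. (\<And>s. s \<notin> Z \<Longrightarrow> 0 \<le> f s) \<Longrightarrow>
      (\<And>s. s \<notin> Z \<Longrightarrow> f s = (\<Sum>a\<in>UNIV. pmf (\<sigma> s) a * (\<Sum>s'\<in>UNIV. T s a s' * f s'))) \<Longrightarrow>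
      (\<And>s. s \<in> Z \<Longrightarrow> f s = reach_from T (target i) (opt i) s) \<Longrightarrow>
      prob_reach T \<beta> \<pi> (target i) \<le> (\<Sum>s\<in>UNIV. pmf \<beta> s * f s)"
    define \<pi>mix :: "('s, 'a) policy" where "\<pi>mix = (\<lambda>_. \<sigma>)"
    define \<pi>ss where "\<pi>ss = switching_policy Z\<phi> Z\<psi> \<pi>mix \<pi>\<psi> \<pi>\<phi>"
    have mix: "is_stationary_policy A \<pi>mix"
      using \<sigma> by (simp add: is_stationary_policy_def is_policy_def \<pi>mix_def)
    have ss_policy: "is_policy A \<pi>ss"
      using \<sigma> opt_policy[of True] opt_policy[of False]
      by (auto simp: is_policy_def \<pi>ss_def switching_policy_def \<pi>mix_def opt_def split: option.splits)
    have "follows_switching Z\<phi> Z\<psi> \<pi>mix \<pi>\<psi> \<pi>\<phi> \<pi>ss"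
      by (auto simp: follows_switching_def Let_def \<pi>ss_def switching_policy_def split: option.splits)
    then have switching: "is_switching_policy A T Z\<phi> Z\<psi> \<pi>ss"
      unfolding is_switching_policy_def using ss_policy mix \<pi>\<phi> \<pi>\<psi> by blast
    \<comment> \<open>A first state off \<open>Z\<close> does not affect where the switch occurs. It
      lengthens the history seen by the later policies, which ignore it by stationarity, so the
      shifted policy is the same one.\<close>
    have before: "shift_policy s a \<pi>ss = \<pi>ss" "\<pi>ss [] s = \<sigma> s" if "s \<notin> Z" for s a
      using that opt_stat[of True] opt_stat[of False]
      by (auto simp: \<pi>ss_def switching_policy_def Z_def \<pi>mix_def fun_eq_iff opt_def split: option.splits)
    \<comment> \<open>Here \<open>s\<close> lies only in the other target set, so the policy optimal
      for target \<open>i\<close> takes over for good.\<close>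
    have after: "shift_policy s a \<pi>ss = shift_policy s a (opt i)" "\<pi>ss [] s = opt i [] s"
      if "s \<in> Z" "s \<notin> target i" for s a i
      using that by (auto simp: \<pi>ss_def switching_policy_def Z_def target_def opt_def fun_eq_iff split: if_splits)
    have "prob_reach T \<beta> \<pi> (target i) \<le> prob_reach T \<beta> \<pi>ss (target i)" for i
      unfolding prob_reach_eq_sum[OF ss_policy, of \<beta>]
    proof (rule dom)
      fix s assume "s \<notin> Z"
      moreover from this have "s \<notin> target i" by (auto simp: Z_def target_def)
      ultimately show "reach_from T (target i) \<pi>ss s
          = (\<Sum>a\<in>UNIV. pmf (\<sigma> s) a * (\<Sum>s'\<in>UNIV. T s a s' * reach_from T (target i) \<pi>ss s'))"
        by (subst reach_from_eq[OF ss_policy]) (simp add: before)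
    next
      fix s assume "s \<in> Z"
      show "reach_from T (target i) \<pi>ss s = reach_from T (target i) (opt i) s"
      proof (cases "s \<in> target i")
        case True
        then show ?thesis by (simp add: reach_from_eq[OF ss_policy] reach_from_eq[OF opt_policy])
      next
        case False
        \<comment> \<open>The two policies agree only on histories starting at \<open>s\<close>, so
          both values are unfolded by one step to expose the shifts.\<close>
        show ?thesis
          by (subst reach_from_eq[OF ss_policy], subst reach_from_eq[OF opt_policy])
            (simp only: after[OF \<open>s \<in> Z\<close> False])
      qed
    qed (rule prob_reach_nonneg)
    from this[of True] this[of False] switching show ?thesis
      by (auto simp: target_def)
  qed
qed

end
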